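(* Let $A$ be a $\mathcal{{}^KOCA}$ (Krivine ordered combinatory algebra). If $I,J$ are sets, $\alpha:J\to I$ is a function, $\varphi\in A^J$ and $\psi\in A^I$, then $$\alpha^*(\psi)\vdash\varphi\iff\psi\vdash\forall_A\alpha(\varphi).$$
   Context: An ordered combinatory algebra (OCA) is $(A,\circ,\le,\mathrm k,\mathrm s)$ with $A$ a set, $\circ:A\times A\to A$ a binary operation (application, $a\circ b=ab$, associating to the left), $\le$ a partial order on $A$, and $\mathrm k,\mathrm s\in A$, such that application is monotone in both arguments and $\mathrm kab\le a$, $\mathrm sabc\le ac(bc)$ for all $a,b,c\in A$. An implication is a map $\to:A\times A\to A$, monotone in the second variable and antimonotone in the first, such that $a\le(b\to c)$ implies $ab\le c$. An adjunctor is an element $\mathrm e\in A$ such that $ab\le c$ implies $\mathrm ea\le(b\to c)$. The OCA is classic if there is $\mathrm c\in A$ with $\mathrm c\le(((a\to b)\to a)\to a)$ for all $a,b$. A filter is a subset $\Phi\subseteq A$ closed under application, containing $\mathrm k$ and $\mathrm s$, containing $\mathrm e$ (when $A$ has an adjunctor $\mathrm e$), and containing $\mathrm c$ if $A$ is classic. A $\mathcal{{}^KOCA}$ is an OCA equipped with an implication $\to$, an adjunctor $\mathrm e$ and a filter $\Phi$, which is inf-complete: every subset $X\subseteq A$ has an infimum $\inf(X)\in A$ with respect to $\le$. Put $\perp=\inf A$ and $\mathrm i=\mathrm{skk}$. For a set $I$, define $\mathrm{eq}_I:I\times I\to A$ by $\mathrm{eq}_I(i,j)=\mathrm i$ if $i=j$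 and $\mathrm{eq}_I(i,j)=\perp$ if $i\ne j$. $A^I$ is the set of functions $I\to A$; $\varphi\vdash\psi$ on $A^I$ means that there is $f\in\Phi$ with $f\varphi(i)\le\psi(i)$ for all $i\in I$. For $\alpha:J\to I$, $\alpha^*:A^I\to A^J$ is $\alpha^*(\psi)=\psi\circ\alpha$ (composition of functions), and for $\varphi\in A^J$, $\forall_A\alpha(\varphi)\in A^I$ is $\forall_A\alpha(\varphi)(i)=\inf_{j\in J}\{\mathrm{eq}_I(\alpha(j),i)\to\varphi(j)\}$. *)

theory Defs
  imports Main "HOL-Library.FuncSet"
begin

record 'a oca =
  app :: "'a \<Rightarrow> 'a \<Rightarrow> 'a" (infixl "\<cdot>\<index>" 70)
  comb_k :: 'a
  comb_s :: 'a

text \<open>The carrier is the whole type (an OCA is nonempty, as it contains k) and the partial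
  order is that of the type class.\<close>

locale oca =
  fixes A :: "('a::order, 'm) oca_scheme" (structure)
  assumes app_mono: "a \<le> a' \<Longrightarrow> b \<le> b' \<Longrightarrow> a \<cdot> b \<le> a' \<cdot> b'"
    and k_le: "comb_k A \<cdot> a \<cdot> b \<le> a"
    and s_le: "comb_s A \<cdot> a \<cdot> b \<cdot> c \<le> a \<cdot> c \<cdot> (b \<cdot> c)"

definition implication :: "('a::order, 'm) oca_scheme \<Rightarrow> ('a \<Rightarrow> 'a \<Rightarrow> 'a) \<Rightarrow> bool" where
  "implication A r \<longleftrightarrow>
     (\<forall>a b b'. b \<le> b' \<longrightarrow> r a b \<le> r a b') \<and>
     (\<forall>a a' b. a \<le> a' \<longrightarrow> r a' b \<le> r a b) \<and>
     (\<forall>a b c. a \<le> r b c \<longrightarrow> a \<cdot>\<^bsub>A\<^esub> b \<le> c)"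

definition adjunctor ::
  "('a::order, 'm) oca_scheme \<Rightarrow> ('a \<Rightarrow> 'a \<Rightarrow> 'a) \<Rightarrow> 'a \<Rightarrow> bool" where
  "adjunctor A r e \<longleftrightarrow> (\<forall>a b c. a \<cdot>\<^bsub>A\<^esub> b \<le> c \<longrightarrow> e \<cdot>\<^bsub>A\<^esub> a \<le> r b c)"

definition peirce :: "('a::order \<Rightarrow> 'a \<Rightarrow> 'a) \<Rightarrow> 'a \<Rightarrow> bool" where
  "peirce r c \<longleftrightarrow> (\<forall>a b. c \<le> r (r (r a b) a) a)"

definition classic :: "('a::order \<Rightarrow> 'a \<Rightarrow> 'a) \<Rightarrow> bool" where
  "classic r \<longleftrightarrow> (\<exists>c. peirce r c)"

text \<open>The element c witnessing classicality is not part of the structure, so a filter of a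
  classic OCA is only required to contain some witness.\<close>

definition oca_filter ::
  "('a::order, 'm) oca_scheme \<Rightarrow> ('a \<Rightarrow> 'a \<Rightarrow> 'a) \<Rightarrow> 'a \<Rightarrow> 'a set \<Rightarrow> bool" where
  "oca_filter A r e \<Phi> \<longleftrightarrow>
     (\<forall>a\<in>\<Phi>. \<forall>b\<in>\<Phi>. a \<cdot>\<^bsub>A\<^esub> b \<in> \<Phi>) \<and>
     comb_k A \<in> \<Phi> \<and> comb_s A \<in> \<Phi> \<and> e \<in> \<Phi> \<and>
     (classic r \<longrightarrow> (\<exists>c\<in>\<Phi>. peirce r c))"

record 'a koca = "'a oca" +
  imp :: "'a \<Rightarrow> 'a \<Rightarrow> 'a" (infixr "\<leadsto>\<index>" 60)
  adj :: 'a
  filt :: "'a set"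

text \<open>Inf-completeness is the class \<^class>\<open>complete_lattice\<close>: a partial order
  in which every subset has an infimum is a complete lattice, in exactly one way.\<close>

locale koca = oca A for A :: "('a::complete_lattice, 'm) koca_scheme" (structure) +
  assumes implication: "implication A (imp A)"
    and adjunctor: "adjunctor A (imp A) (adj A)"
    and filt: "oca_filter A (imp A) (adj A) (filt A)"

definition oca_bot :: "('a::complete_lattice, 'm) oca_scheme \<Rightarrow> 'a" where
  "oca_bot A = Inf (UNIV :: 'a set)"

definition comb_i :: "('a, 'm) oca_scheme \<Rightarrow> 'a" where
  "comb_i A = comb_s A \<cdot>\<^bsub>A\<^esub> comb_k A \<cdot>\<^bsub>A\<^esub> comb_k A"

definition eq_pred :: "('a::complete_lattice, 'm) oca_scheme \<Rightarrow> 'i \<Rightarrow> 'i \<Rightarrow> 'a" where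
  "eq_pred A i j = (if i = j then comb_i A else oca_bot A)"

text \<open>Index sets are sets, not types, since they may be empty. An element of \<open>A\<^sup>I\<close>
  is a total function of which only the values on \<open>I\<close> matter.\<close>

definition entails ::
  "('a::order, 'm) koca_scheme \<Rightarrow> 'i set \<Rightarrow> ('i \<Rightarrow> 'a) \<Rightarrow> ('i \<Rightarrow> 'a) \<Rightarrow> bool" where
  "entails A I \<phi> \<psi> \<longleftrightarrow> (\<exists>f\<in>filt A. \<forall>i\<in>I. f \<cdot>\<^bsub>A\<^esub> \<phi> i \<le> \<psi> i)"

definition reindex :: "('j \<Rightarrow> 'i) \<Rightarrow> ('i \<Rightarrow> 'a) \<Rightarrow> 'j \<Rightarrow> 'a" where
  "reindex \<alpha> \<psi> = \<psi> \<circ> \<alpha>"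

definition forall_along ::
  "('a::complete_lattice, 'm) koca_scheme \<Rightarrow> 'j set \<Rightarrow> ('j \<Rightarrow> 'i) \<Rightarrow> ('j \<Rightarrow> 'a) \<Rightarrow> 'i \<Rightarrow> 'a" where
  "forall_along A J \<alpha> \<phi> i = (INF j\<in>J. eq_pred A (\<alpha> j) i \<leadsto>\<^bsub>A\<^esub> \<phi> j)"

end

theory Submission
  imports Defs
begin

text \<open>
  Entailment asks for one realizer in the filter that works uniformly for all indices, so each
  direction is a program transformation that turns a realizer \<open>f\<close> of one side into a
  realizer of the other.

  From right to left, a realizer of \<open>\<psi> \<turnstile> \<forall>\<alpha>(\<phi>)\<close>
  taken at the index \<open>\<alpha> j\<close> is waiting for a proof of
  \<open>\<alpha> j = \<alpha> j\<close>, which is the identity combinator \<open>i\<close>; so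
  \<open>\<lambda>a. f a i\<close> works.

  From left to right, the new realizer must accept a putative proof \<open>b\<close> of
  \<open>\<alpha> j = i\<close> without being able to test whether the equality holds. The trick is
  to let \<open>b\<close> act: use \<open>\<lambda>a b. b (f a)\<close>. If the equality holds then
  \<open>b = i\<close>, and the result is below \<open>f a\<close>; if it fails then
  \<open>b = \<bottom>\<close>, and \<open>\<bottom>\<close> absorbs every argument
  (lemma \<open>bot_app\<close>), so the result is below anything. The adjunctor then moves
  \<open>b\<close> to the right of \<open>\<le>\<close>.

  Application only satisfies inequalities instead of the equations of combinatory logic, but
  bracket abstraction by hand still gives the realizers, because the inequalities go the right
  way.
\<close>

context oca
begin

lemma app_mono_left: "a \<le> a' \<Longrightarrow> a \<cdot> b \<le> a' \<cdot> b"
  by (simp add: app_mono)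

lemma app_mono_right: "b \<le> b' \<Longrightarrow> a \<cdot> b \<le> a \<cdot> b'"
  by (simp add: app_mono)

lemma comb_i_le: "comb_i A \<cdot> a \<le> a"
  unfolding comb_i_def using s_le k_le by (rule order_trans)

definition comb_comp :: "'a \<Rightarrow> 'a \<Rightarrow> 'a" where
  "comb_comp x y = comb_s A \<cdot> (comb_k A \<cdot> x) \<cdot> y"

lemma comb_comp_le: "comb_comp x y \<cdot> a \<le> x \<cdot> (y \<cdot> a)"
  unfolding comb_comp_def using s_le app_mono_left[OF k_le] by (rule order_trans)

text \<open>The bracket abstraction of \<open>\<lambda>a. f a x\<close>.\<close>

definition comb_supply :: "'a \<Rightarrow> 'a \<Rightarrow> 'a" where
  "comb_supply f x = comb_s A \<cdot> f \<cdot> (comb_k A \<cdot> x)"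

lemma comb_supply_le: "comb_supply f x \<cdot> a \<le> f \<cdot> a \<cdot> x"
  unfolding comb_supply_def using s_le app_mono_right[OF k_le] by (rule order_trans)

text \<open>Supplying \<open>x\<close> to the identity gives \<open>\<lambda>b. b x\<close>.\<close>

lemma comb_supply_i_le: "comb_supply (comb_i A) x \<cdot> b \<le> b \<cdot> x"
  using comb_supply_le app_mono_left[OF comb_i_le] by (rule order_trans)

end

context koca
begin

lemma imp_elim: "a \<le> b \<leadsto> c \<Longrightarrow> a \<cdot> b \<le> c"
  using implication unfolding implication_def by blast

lemma adj_intro: "a \<cdot> b \<le> c \<Longrightarrow> adj A \<cdot> a \<le> b \<leadsto> c"
  using adjunctor unfolding adjunctor_def by blast

text \<open>The bottom is below the implication from \<open>x\<close> to any \<open>c\<close>, so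
  applying it to \<open>x\<close> gives something below every \<open>c\<close>.\<close>

lemma bot_app: "oca_bot A \<cdot> x \<le> c"
  by (rule imp_elim) (simp add: oca_bot_def)

lemma
  shows filt_app: "f \<in> filt A \<Longrightarrow> g \<in> filt A \<Longrightarrow> f \<cdot> g \<in> filt A"
    and filt_k: "comb_k A \<in> filt A"
    and filt_s: "comb_s A \<in> filt A"
    and filt_adj: "adj A \<in> filt A"
  using filt unfolding oca_filter_def by blast+

lemma filt_i: "comb_i A \<in> filt A"
  unfolding comb_i_def by (intro filt_app filt_k filt_s)

lemma filt_comp: "f \<in> filt A \<Longrightarrow> g \<in> filt A \<Longrightarrow> comb_comp f g \<in> filt A"
  unfolding comb_comp_def by (intro filt_app filt_k filt_s)

lemma filt_supply: "f \<in> filt A \<Longrightarrow> x \<in> filt A \<Longrightarrow> comb_supply f x \<in> filt A"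
  unfolding comb_supply_def by (intro filt_app filt_k filt_s)

text \<open>The bracket abstraction of \<open>\<lambda>a. e (\<lambda>b. b (f a))\<close>, where
  \<open>e\<close> is the adjunctor: \<open>\<lambda>b. b x\<close> is \<open>s i (k x)\<close>, which
  depends on \<open>x\<close> through the composite of \<open>s i\<close> and \<open>k\<close>.\<close>

definition comb_guard :: "'a \<Rightarrow> 'a" where
  "comb_guard f =
     comb_comp (adj A) (comb_comp (comb_s A \<cdot> comb_i A) (comb_comp (comb_k A) f))"

lemma filt_guard: "f \<in> filt A \<Longrightarrow> comb_guard f \<in> filt A"
  unfolding comb_guard_def by (intro filt_comp filt_app filt_adj filt_s filt_i filt_k)

lemma comb_guard_le: "comb_guard f \<cdot> a \<le> adj A \<cdot> comb_supply (comb_i A) (f \<cdot> a)"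
proof -
  have "comb_guard f \<cdot> a
      \<le> adj A \<cdot> (comb_comp (comb_s A \<cdot> comb_i A) (comb_comp (comb_k A) f) \<cdot> a)"
    unfolding comb_guard_def by (rule comb_comp_le)
  also have "\<dots> \<le> adj A \<cdot> (comb_s A \<cdot> comb_i A \<cdot> (comb_comp (comb_k A) f \<cdot> a))"
    by (intro app_mono_right comb_comp_le)
  also have "\<dots> \<le> adj A \<cdot> (comb_s A \<cdot> comb_i A \<cdot> (comb_k A \<cdot> (f \<cdot> a)))"
    by (intro app_mono_right comb_comp_le)
  finally show ?thesis unfolding comb_supply_def .
qed

lemma comb_guard_le_imp:
  assumes "b \<cdot> (f \<cdot> a) \<le> c"
  shows "comb_guard f \<cdot> a \<le> b \<leadsto> c"
  using comb_guard_le adj_intro[OF order_trans[OF comb_supply_i_le assms]] by (rule order_trans)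

text \<open>A truth value of equality, used as a program, is the identity or absorbs its argument;
  so what it returns only has to be correct when the equality holds.\<close>

lemma eq_pred_app_le:
  assumes "i = j \<Longrightarrow> x \<le> c"
  shows "eq_pred A i j \<cdot> x \<le> c"
proof (cases "i = j")
  case True
  then show ?thesis
    using order_trans[OF comb_i_le assms] by (simp add: eq_pred_def)
next
  case False
  then show ?thesis by (simp add: eq_pred_def bot_app)
qed

lemma entails_forall_along_intro:
  assumes "entails A J (reindex \<alpha> \<psi>) \<phi>"
  shows "entails A I \<psi> (forall_along A J \<alpha> \<phi>)"
proof -
  obtain f where f: "f \<in> filt A" and le: "\<And>j. j \<in> J \<Longrightarrow> f \<cdot> \<psi> (\<alpha> j) \<le> \<phi> j"
    using assms unfolding entails_def reindex_def by auto
  have "comb_guard f \<cdot> \<psi> i \<le> forall_along A J \<alpha> \<phi> i" for i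
    unfolding forall_along_def
    using le by (auto intro!: INF_greatest comb_guard_le_imp eq_pred_app_le)
  then show ?thesis
    unfolding entails_def using filt_guard[OF f] by blast
qed

lemma entails_forall_along_elim:
  assumes \<alpha>: "\<alpha> \<in> J \<rightarrow> I" and "entails A I \<psi> (forall_along A J \<alpha> \<phi>)"
  shows "entails A J (reindex \<alpha> \<psi>) \<phi>"
proof -
  obtain f where f: "f \<in> filt A"
    and le: "\<And>i. i \<in> I \<Longrightarrow> f \<cdot> \<psi> i \<le> forall_along A J \<alpha> \<phi> i"
    using assms(2) unfolding entails_def by auto
  have "comb_supply f (comb_i A) \<cdot> \<psi> (\<alpha> j) \<le> \<phi> j" if j: "j \<in> J" for j
  proof -
    have "f \<cdot> \<psi> (\<alpha> j) \<le> forall_along A J \<alpha> \<phi> (\<alpha> j)"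
      using le \<alpha> j by blast
    also have "\<dots> \<le> eq_pred A (\<alpha> j) (\<alpha> j) \<leadsto> \<phi> j"
      unfolding forall_along_def using j by (rule INF_lower)
    finally have "f \<cdot> \<psi> (\<alpha> j) \<cdot> comb_i A \<le> \<phi> j"
      by (simp add: eq_pred_def imp_elim)
    with comb_supply_le show ?thesis by (rule order_trans)
  qed
  then show ?thesis
    unfolding entails_def reindex_def using filt_supply[OF f filt_i] by auto
qed

end

theorem theorem8p13:
  fixes A :: "'a::complete_lattice koca"
    and I :: "'i set" and J :: "'j set"
    and \<alpha> :: "'j \<Rightarrow> 'i" and \<phi> :: "'j \<Rightarrow> 'a" and \<psi> :: "'i \<Rightarrow> 'a"
  assumes "koca A"
    and "\<alpha> \<in> J \<rightarrow> I"
  shows "entails A J (reindex \<alpha> \<psi>) \<phi> \<longleftrightarrow> entails A I \<psi> (forall_along A J \<alpha> \<phi>)"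
  using koca.entails_forall_along_intro[OF assms(1)]
    koca.entails_forall_along_elim[OF assms]
  by blast

end
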